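(* Let $\mathscr{H}\subset B=(-1,-1)_{\mathbb{Q}}$ be the ring of Hurwitz quaternion integers, and let $p\mathscr{H}$ be the prime ideal generated by an odd rational prime $p\in\mathbb{Z}$. Then there exists an isomorphism $$\Psi:\ \mathscr{H}/p\mathscr{H}\ \longrightarrow\ \mathscr{H}/\mathscr{H}\pi\ \times\ \mathscr{H}/\mathscr{H}\overline{\pi},$$ where $\mathscr{H}\pi$ and $\mathscr{H}\overline{\pi}$ are left prime ideals with $\mathrm{Nrm}(\pi)=p$ and $\mathrm{Re}(\pi)\in\{1,2\}$.
   Context: $(-1,-1)_{\mathbb{Q}}$ is the quaternion algebra over $\mathbb{Q}$ with basis $1,i,j,k$ and relations $i^2=j^2=-1$, $ij=k=-ji$. The Hurwitz quaternion integers are $$\mathscr{H}=\left\{a_1+a_2 i+a_3 j+a_4\tfrac{1+i+j+k}{2}\ :\ a_1,\dots,a_4\in\mathbb{Z}\right\},$$ a maximal order in $(-1,-1)_{\mathbb{Q}}$. For $\alpha=a+bi+cj+dk$, the conjugate is $\overline{\alpha}=a-bi-cj-dk$, the norm is $\mathrm{Nrm}(\alpha)=\alpha\overline{\alpha}=a^2+b^2+c^2+d^2$, and $\mathrm{Re}(\alpha)=a$. For $\alpha\in\mathscr{H}$, $\mathscr{H}\alpha=\{h\alpha: h\in\mathscr{H}\}$ is the left ideal generated by $\alpha$. A rational prime is a prime number $p>1$ in $\mathbb{N}$; for every odd rational prime $p$ there is an irreducible $\pi\in\mathscr{H}$ with $\mathrm{Nrm}(\pi)=p$ and $\mathrm{Re}(\pi)\in\{1,2\}$.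 A two-sided ideal $\mathfrak{P}\subsetneq\mathscr{H}$ is prime if for two-sided ideals $\mathfrak{U},\mathfrak{W}\subset\mathscr{H}$, $\mathfrak{U}\mathfrak{W}\subset\mathfrak{P}$ implies $\mathfrak{U}\subset\mathfrak{P}$ or $\mathfrak{W}\subset\mathfrak{P}$. A left ideal $\mathfrak{p}\subsetneq\mathscr{H}$ is left prime if for left ideals $\mathfrak{a},\mathfrak{b}\subset\mathscr{H}$, $\mathfrak{a}\mathfrak{b}\subset\mathfrak{p}$ implies $\mathfrak{a}\subset\mathfrak{p}$ or $\mathfrak{b}\subset\mathfrak{p}$. *)

theory Defs
  imports
    Complex_Main
    "HOL-Computational_Algebra.Primes"
    "HOL-Algebra.Ideal_Product"
    "HOL-Algebra.Module"
begin

section \<open>The rational quaternion algebra $(-1,-1)$ over the rationals\<close>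

text \<open>\<open>Quat a b c d\<close> stands for $a + bi + cj + dk$.\<close>

datatype quat = Quat (qre: rat) (qim1: rat) (qim2: rat) (qim3: rat)

lemma quat_eq_iff:
  "x = y \<longleftrightarrow> qre x = qre y \<and> qim1 x = qim1 y \<and> qim2 x = qim2 y \<and> qim3 x = qim3 y"
  by (cases x; cases y) auto

instantiation quat :: ring_1
begin

definition "0 = Quat 0 0 0 0"
definition "1 = Quat 1 0 0 0"
definition "x + y = Quat (qre x + qre y) (qim1 x + qim1 y) (qim2 x + qim2 y) (qim3 x + qim3 y)"
definition "- x = Quat (- qre x) (- qim1 x) (- qim2 x) (- qim3 x)"
definition "x - y = Quat (qre x - qre y) (qim1 x - qim1 y) (qim2 x - qim2 y) (qim3 x - qim3 y)"
definition "x * y = Quat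
  (qre x * qre y - qim1 x * qim1 y - qim2 x * qim2 y - qim3 x * qim3 y)
  (qre x * qim1 y + qim1 x * qre y + qim2 x * qim3 y - qim3 x * qim2 y)
  (qre x * qim2 y - qim1 x * qim3 y + qim2 x * qre y + qim3 x * qim1 y)
  (qre x * qim3 y + qim1 x * qim2 y - qim2 x * qim1 y + qim3 x * qre y)"

lemmas quat_arith_defs =
  zero_quat_def one_quat_def plus_quat_def uminus_quat_def minus_quat_def times_quat_def

instance
  by standard (simp_all add: quat_arith_defs algebra_simps)

end

lemma quat_sel [simp]:
  "qre 0 = 0" "qim1 0 = 0" "qim2 0 = 0" "qim3 0 = 0"
  "qre 1 = 1" "qim1 1 = 0" "qim2 1 = 0" "qim3 1 = 0"
  "qre (x + y) = qre x + qre y" "qim1 (x + y) = qim1 x + qim1 y"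
  "qim2 (x + y) = qim2 x + qim2 y" "qim3 (x + y) = qim3 x + qim3 y"
  "qre (- x) = - qre x" "qim1 (- x) = - qim1 x" "qim2 (- x) = - qim2 x" "qim3 (- x) = - qim3 x"
  "qre (x - y) = qre x - qre y" "qim1 (x - y) = qim1 x - qim1 y"
  "qim2 (x - y) = qim2 x - qim2 y" "qim3 (x - y) = qim3 x - qim3 y"
  by (simp_all add: quat_arith_defs)

lemma quat_sel_mult [simp]:
  "qre (x * y) = qre x * qre y - qim1 x * qim1 y - qim2 x * qim2 y - qim3 x * qim3 y"
  "qim1 (x * y) = qre x * qim1 y + qim1 x * qre y + qim2 x * qim3 y - qim3 x * qim2 y"
  "qim2 (x * y) = qre x * qim2 y - qim1 x * qim3 y + qim2 x * qre y + qim3 x * qim1 y"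
  "qim3 (x * y) = qre x * qim3 y + qim1 x * qim2 y - qim2 x * qim1 y + qim3 x * qre y"
  by (simp_all add: times_quat_def)

lemma quat_of_nat: "of_nat n = Quat (of_nat n) 0 0 0"
  by (induction n) (simp_all add: quat_eq_iff)

lemma quat_of_int: "of_int n = Quat (of_int n) 0 0 0"
  by (cases n) (simp_all add: quat_of_nat quat_eq_iff)

definition qi :: quat where "qi = Quat 0 1 0 0"
definition qj :: quat where "qj = Quat 0 0 1 0"
definition qk :: quat where "qk = Quat 0 0 0 1"

lemma quat_relations:
  "qi * qi = -1" "qj * qj = -1" "qi * qj = qk" "qj * qi = - qk"
  by (simp_all add: qi_def qj_def qk_def quat_eq_iff)

definition qcnj :: "quat \<Rightarrow> quat" where
  "qcnj x = Quat (qre x) (- qim1 x) (- qim2 x) (- qim3 x)"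

definition qnrm :: "quat \<Rightarrow> rat" where
  "qnrm x = (qre x)^2 + (qim1 x)^2 + (qim2 x)^2 + (qim3 x)^2"

lemma mult_qcnj: "x * qcnj x = Quat (qnrm x) 0 0 0"
  by (simp add: quat_eq_iff qcnj_def qnrm_def power2_eq_square)


section \<open>The Hurwitz order\<close>

definition qomega :: quat where "qomega = Quat (1/2) (1/2) (1/2) (1/2)"

definition hurwitz :: "quat set" where
  "hurwitz = {of_int a1 + of_int a2 * qi + of_int a3 * qj + of_int a4 * qomega | a1 a2 a3 a4. True}"

definition hurwitz_ring :: "quat ring" where
  "hurwitz_ring = \<lparr>carrier = hurwitz, mult = (*), one = 1, zero = 0, add = (+)\<rparr>"

lemma hurwitzI:
  assumes "x = Quat (of_int a1 + of_int a4 / 2) (of_int a2 + of_int a4 / 2)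
                    (of_int a3 + of_int a4 / 2) (of_int a4 / 2)"
  shows "x \<in> hurwitz"
proof -
  have "x = of_int a1 + of_int a2 * qi + of_int a3 * qj + of_int a4 * qomega"
    using assms by (simp add: quat_eq_iff quat_of_int qi_def qj_def qomega_def)
  then show ?thesis unfolding hurwitz_def by blast
qed

lemma hurwitzE:
  assumes "x \<in> hurwitz"
  obtains a1 a2 a3 a4 where
    "x = Quat (of_int a1 + of_int a4 / 2) (of_int a2 + of_int a4 / 2)
              (of_int a3 + of_int a4 / 2) (of_int a4 / 2)"
proof -
  obtain a1 a2 a3 a4 where
    "x = of_int a1 + of_int a2 * qi + of_int a3 * qj + of_int a4 * qomega"
    using assms unfolding hurwitz_def by blast
  then have "x = Quat (of_int a1 + of_int a4 / 2) (of_int a2 + of_int a4 / 2)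
              (of_int a3 + of_int a4 / 2) (of_int a4 / 2)"
    by (simp add: quat_eq_iff quat_of_int qi_def qj_def qomega_def)
  then show ?thesis by (rule that)
qed

lemma hurwitz_0: "0 \<in> hurwitz"
  by (rule hurwitzI[of _ 0 0 0 0]) (simp add: quat_eq_iff)

lemma hurwitz_1: "1 \<in> hurwitz"
  by (rule hurwitzI[of _ 1 0 0 0]) (simp add: quat_eq_iff)

lemma hurwitz_add:
  assumes "x \<in> hurwitz" "y \<in> hurwitz" shows "x + y \<in> hurwitz"
proof -
  obtain a1 a2 a3 a4 where x: "x = Quat (of_int a1 + of_int a4 / 2) (of_int a2 + of_int a4 / 2)
      (of_int a3 + of_int a4 / 2) (of_int a4 / 2)" by (rule hurwitzE[OF assms(1)])
  obtain b1 b2 b3 b4 where y: "y = Quat (of_int b1 + of_int b4 / 2) (of_int b2 + of_int b4 / 2)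
      (of_int b3 + of_int b4 / 2) (of_int b4 / 2)" by (rule hurwitzE[OF assms(2)])
  show ?thesis
    by (rule hurwitzI[of _ "a1 + b1" "a4 + b4" "a2 + b2" "a3 + b3"])
      (simp add: x y quat_eq_iff field_simps)
qed

lemma hurwitz_uminus:
  assumes "x \<in> hurwitz" shows "- x \<in> hurwitz"
proof -
  obtain a1 a2 a3 a4 where x: "x = Quat (of_int a1 + of_int a4 / 2) (of_int a2 + of_int a4 / 2)
      (of_int a3 + of_int a4 / 2) (of_int a4 / 2)" by (rule hurwitzE[OF assms])
  show ?thesis
    by (rule hurwitzI[of _ "- a1" "- a4" "- a2" "- a3"]) (simp add: x quat_eq_iff)
qed

lemma hurwitz_mult:
  assumes "x \<in> hurwitz" "y \<in> hurwitz" shows "x * y \<in> hurwitz"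
proof -
  obtain a1 a2 a3 a4 where x: "x = Quat (of_int a1 + of_int a4 / 2) (of_int a2 + of_int a4 / 2)
      (of_int a3 + of_int a4 / 2) (of_int a4 / 2)" by (rule hurwitzE[OF assms(1)])
  obtain b1 b2 b3 b4 where y: "y = Quat (of_int b1 + of_int b4 / 2) (of_int b2 + of_int b4 / 2)
      (of_int b3 + of_int b4 / 2) (of_int b4 / 2)" by (rule hurwitzE[OF assms(2)])
  show ?thesis
    by (rule hurwitzI[of _
          "a1*b1 - a2*b2 - a3*b3 - a2*b3 + a3*b2 - a2*b4 - a4*b3 - a4*b4"
          "2*(a2*b3 - a3*b2) + a1*b4 + a2*b4 - a3*b4 + a4*b3 - a4*b2 + a4*b1 + a4*b4"
          "a1*b2 + a2*b1 - a2*b3 + a3*b2 + a4*b2 + a3*b4 - a4*b3"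
          "a1*b3 + a3*b1 - a2*b3 + a3*b2 - a2*b4 + a3*b4 + a4*b2"])
      (simp add: x y quat_eq_iff field_simps)
qed

lemma ring_hurwitz_ring: "ring hurwitz_ring"
proof (rule ringI)
  show "abelian_group hurwitz_ring"
  proof (rule abelian_groupI)
    fix x assume "x \<in> carrier hurwitz_ring"
    then show "\<exists>y\<in>carrier hurwitz_ring. y \<oplus>\<^bsub>hurwitz_ring\<^esub> x = \<zero>\<^bsub>hurwitz_ring\<^esub>"
      by (intro bexI[of _ "- x"]) (simp_all add: hurwitz_ring_def hurwitz_uminus)
  qed (simp_all add: hurwitz_ring_def hurwitz_add hurwitz_0 add.assoc add.commute)
  show "monoid hurwitz_ring"
    by (rule monoidI) (simp_all add: hurwitz_ring_def hurwitz_mult hurwitz_1 mult.assoc)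
qed (simp_all add: hurwitz_ring_def distrib_left distrib_right)


section \<open>Ideals of noncommutative rings\<close>

locale left_ideal = additive_subgroup I R + ring R for I and R (structure) +
  assumes I_l_closed: "\<lbrakk>a \<in> I; x \<in> carrier R\<rbrakk> \<Longrightarrow> x \<otimes> a \<in> I"

text \<open>
  The library predicate \<open>primeideal\<close> is the elementwise notion for commutative rings.
  The product \<open>U \<cdot>\<^bsub>R\<^esub> W\<close> is the set of finite sums of products \<open>u \<otimes>\<^bsub>R\<^esub> w\<close>.
\<close>

definition two_sided_prime :: "('a, 'm) ring_scheme \<Rightarrow> 'a set \<Rightarrow> bool" where
  "two_sided_prime R P \<longleftrightarrow> ideal P R \<and> P \<noteq> carrier R \<and>
     (\<forall>U W. ideal U R \<longrightarrow> ideal W R \<longrightarrow> U \<cdot>\<^bsub>R\<^esub> W \<subseteq> P \<longrightarrow> U \<subseteq> P \<or> W \<subseteq> P)"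

definition left_prime :: "('a, 'm) ring_scheme \<Rightarrow> 'a set \<Rightarrow> bool" where
  "left_prime R P \<longleftrightarrow> left_ideal P R \<and> P \<noteq> carrier R \<and>
     (\<forall>A B. left_ideal A R \<longrightarrow> left_ideal B R \<longrightarrow> A \<cdot>\<^bsub>R\<^esub> B \<subseteq> P \<longrightarrow> A \<subseteq> P \<or> B \<subseteq> P)"


section \<open>Left modules\<close>

text \<open>
  Left modules over a noncommutative ring are represented by the record type \<open>module\<close>,
  whose fields \<open>mult\<close> and \<open>one\<close> are irrelevant (they are inherited from \<open>ring\<close>).
\<close>

definition quot_module :: "('a, 'm) ring_scheme \<Rightarrow> 'a set \<Rightarrow> ('a, 'a set) module" where
  "quot_module R I =
     \<lparr>carrier = a_rcosets\<^bsub>R\<^esub> I, mult = undefined, one = undefined, zero = I, add = set_add R,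
      smult = (\<lambda>r X. \<Union>x\<in>X. I +>\<^bsub>R\<^esub> (r \<otimes>\<^bsub>R\<^esub> x))\<rparr>"

definition prod_module ::
  "('r, 'a, 'm) module_scheme \<Rightarrow> ('r, 'b, 'n) module_scheme \<Rightarrow> ('r, 'a \<times> 'b) module" where
  "prod_module M N =
     \<lparr>carrier = carrier M \<times> carrier N, mult = undefined, one = undefined,
      zero = (\<zero>\<^bsub>M\<^esub>, \<zero>\<^bsub>N\<^esub>),
      add = (\<lambda>(x, y) (x', y'). (x \<oplus>\<^bsub>M\<^esub> x', y \<oplus>\<^bsub>N\<^esub> y')),
      smult = (\<lambda>r (x, y). (r \<odot>\<^bsub>M\<^esub> x, r \<odot>\<^bsub>N\<^esub> y))\<rparr>"

definition left_module_iso ::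
  "('r, 'k) ring_scheme \<Rightarrow> ('r, 'a, 'm) module_scheme \<Rightarrow> ('r, 'b, 'n) module_scheme \<Rightarrow> ('a \<Rightarrow> 'b) set" where
  "left_module_iso R M N =
     {f \<in> iso (add_monoid M) (add_monoid N).
        \<forall>r\<in>carrier R. \<forall>x\<in>carrier M. f (r \<odot>\<^bsub>M\<^esub> x) = r \<odot>\<^bsub>N\<^esub> f x}"

lemma (in left_ideal) quot_module_smult:
  assumes r: "r \<in> carrier R" and x: "x \<in> carrier R"
  shows "r \<odot>\<^bsub>quot_module R I\<^esub> (I +> x) = I +> (r \<otimes> x)"
proof -
  interpret abelian_subgroup I R
    by (rule abelian_subgroupI3) (unfold_locales)
  have *: "I +> (r \<otimes> y) = I +> (r \<otimes> x)" if y: "y \<in> I +> x" for y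
  proof -
    obtain a where a: "a \<in> I" "y = a \<oplus> x"
      using y by (auto simp: a_r_coset_def')
    then have "r \<otimes> y = (r \<otimes> a) \<oplus> (r \<otimes> x)"
      using r x by (simp add: r_distr)
    then have "r \<otimes> y \<in> I +> (r \<otimes> x)"
      using a I_l_closed[OF a(1) r] by (auto simp: a_r_coset_def')
    then show ?thesis
      using a_repr_independence[OF _ _ a_subgroup, of "r \<otimes> y" "r \<otimes> x"] r x by simp
  qed
  have "x \<in> I +> x" using x by (rule a_rcos_self)
  then have "(\<Union>y\<in>I +> x. I +> (r \<otimes> y)) = I +> (r \<otimes> x)" using * by blast
  then show ?thesis by (simp add: quot_module_def)
qed

end

theory Submission
  imports Defs
begin

text \<open>
  If \<open>P\<close> is a left ideal, \<open>U \<cdot> W \<subseteq> P\<close> and \<open>W + P\<close> is the whole ring, then \<open>U\<close> is contained in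
  \<open>U (W + P) \<subseteq> P\<close>; so maximal left ideals are left prime and maximal two-sided ideals are prime.
  If \<open>b \<notin> \<H>\<pi>\<close>, then some \<open>b + h\<pi>\<close> has norm prime to \<open>p\<close>, which makes \<open>\<H>\<pi>\<close> maximal without
  the Euclidean algorithm; and \<open>w - iwi - jwj - kwk = 4 Re w\<close> produces an integer prime to \<open>p\<close> in
  every two-sided ideal not contained in \<open>p\<H>\<close>. Since \<open>\<pi> + qcnj \<pi>\<close> is 2 or 4, hence prime to \<open>p\<close>,
  the left ideals of \<open>\<pi>\<close> and \<open>qcnj \<pi>\<close> are comaximal with intersection \<open>p\<H>\<close>, and the Chinese
  remainder theorem for left modules gives the isomorphism.
\<close>

section \<open>Left ideals\<close>

lemma (in ideal) left_ideal: "left_ideal I R"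
  by unfold_locales (rule I_l_closed)

lemma (in abelian_group) add_minus_add_left:
  assumes "x \<in> carrier G" "y \<in> carrier G" "z \<in> carrier G"
  shows "(x \<oplus> y) \<ominus> (x \<oplus> z) = y \<ominus> z"
  using assms a_lcomm[of y x "\<ominus> x \<oplus> \<ominus> z"]
  by (simp add: a_minus_def minus_add a_assoc r_neg1 r_neg2)

context left_ideal
begin

lemma abelian_subgroup: "abelian_subgroup I R"
  by (rule abelian_subgroupI3) unfold_locales

lemma rcos_eq_iff:
  assumes "x \<in> carrier R" "y \<in> carrier R"
  shows "I +> x = I +> y \<longleftrightarrow> x \<ominus> y \<in> I"
proof -
  interpret abelian_subgroup I R by (rule abelian_subgroup)
  have "I +> x = I +> y \<longleftrightarrow> x \<in> I +> y"
    using a_repr_independence[OF _ assms(2) a_subgroup, of x] a_rcos_self[OF assms(1)] by metis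
  then show ?thesis
    using a_rcos_module_minus[OF ring_axioms assms(2,1)] by simp
qed

section \<open>Primality from comaximality\<close>

text \<open>An element of \<open>U\<close> multiplies \<open>q\<close> only from the left, so it is
  enough that \<open>I\<close> is a left ideal. This is why the right factor \<open>W\<close> is the
  one comaximal with \<open>I\<close>.\<close>

lemma ideal_prod_subset_comaximal:
  assumes U: "left_ideal U R" and W: "left_ideal W R" and UW: "U \<cdot> W \<subseteq> I"
    and w: "w \<in> W" and q: "q \<in> I" and wq: "w \<oplus> q = \<one>"
  shows "U \<subseteq> I"
proof
  interpret U: left_ideal U R by (rule U)
  interpret W: left_ideal W R by (rule W)
  fix u assume u: "u \<in> U"
  have "u \<otimes> w \<in> I" using UW ideal_prod.prod[OF u w] by blast
  moreover have "u \<otimes> q \<in> I" using q u by (simp add: I_l_closed)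
  moreover have "u = u \<otimes> w \<oplus> u \<otimes> q"
    using u w q wq by (metis U.a_Hcarr W.a_Hcarr a_Hcarr r_distr r_one)
  ultimately show "u \<in> I" using additive_subgroup.a_closed[OF additive_subgroup_axioms] by metis
qed

text \<open>The premise \<open>comax\<close> is maximality among left ideals in element form, the
  shape in which a Bezout identity delivers it.\<close>

lemma left_primeI:
  assumes "\<one> \<notin> I"
    and comax: "\<And>b. \<lbrakk>b \<in> carrier R; b \<notin> I\<rbrakk> \<Longrightarrow> \<exists>r\<in>carrier R. \<exists>q\<in>I. r \<otimes> b \<oplus> q = \<one>"
  shows "left_prime R I"
  unfolding left_prime_def
proof (intro conjI allI impI)
  show "left_ideal I R" by (rule left_ideal_axioms)
  show "I \<noteq> carrier R" using assms(1) by auto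
  fix A B assume A: "left_ideal A R" and B: "left_ideal B R" and AB: "A \<cdot> B \<subseteq> I"
  interpret B: left_ideal B R by (rule B)
  show "A \<subseteq> I \<or> B \<subseteq> I"
  proof (cases "B \<subseteq> I")
    case False
    then obtain b where b: "b \<in> B" "b \<notin> I" by blast
    then obtain r q where "r \<in> carrier R" "q \<in> I" "r \<otimes> b \<oplus> q = \<one>"
      using comax by (meson B.a_Hcarr)
    then show ?thesis
      using ideal_prod_subset_comaximal[OF A B AB] B.I_l_closed[OF b(1)] by blast
  qed simp
qed

end

text \<open>Maximality is tested only against two-sided ideals, because a prime two-sided ideal may
  lie properly inside a proper left ideal.\<close>

lemma (in ideal) two_sided_primeI:
  assumes "\<one> \<notin> I"
    and comax: "\<And>W. \<lbrakk>ideal W R; \<not> W \<subseteq> I\<rbrakk> \<Longrightarrow> \<exists>w\<in>W. \<exists>q\<in>I. w \<oplus> q = \<one>"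
  shows "two_sided_prime R I"
  unfolding two_sided_prime_def
proof (intro conjI allI impI)
  show "ideal I R" by (rule ideal_axioms)
  show "I \<noteq> carrier R" using assms(1) by auto
  fix U W assume UW: "ideal U R" "ideal W R" "U \<cdot> W \<subseteq> I"
  show "U \<subseteq> I \<or> W \<subseteq> I"
    using comax[OF UW(2)] UW
      left_ideal.ideal_prod_subset_comaximal[OF left_ideal, OF ideal.left_ideal ideal.left_ideal]
    by blast
qed

lemma (in ring) cgenideal_left_ideal:
  assumes a: "a \<in> carrier R"
  shows "left_ideal (PIdl a) R"
proof -
  have "subgroup (PIdl a) (add_monoid R)"
  proof (rule add.subgroupI)
    show "PIdl a \<subseteq> carrier R" "PIdl a \<noteq> {}" using a by (auto simp: cgenideal_def)
    fix x assume "x \<in> PIdl a"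
    then obtain r where "r \<in> carrier R" "x = r \<otimes> a" by (auto simp: cgenideal_def)
    then show "\<ominus> x \<in> PIdl a"
      using a by (auto simp: cgenideal_def intro!: exI[of _ "\<ominus> r"] simp: l_minus)
    fix y assume "y \<in> PIdl a"
    then obtain s where "s \<in> carrier R" "y = s \<otimes> a" by (auto simp: cgenideal_def)
    then show "x \<oplus> y \<in> PIdl a"
      using a \<open>r \<in> carrier R\<close> \<open>x = r \<otimes> a\<close>
      by (auto simp: cgenideal_def intro!: exI[of _ "r \<oplus> s"] simp: l_distr)
  qed
  moreover have "x \<otimes> y \<in> PIdl a" if "y \<in> PIdl a" "x \<in> carrier R" for x y
    using that a by (auto simp: cgenideal_def m_assoc[symmetric])
  ultimately show ?thesis
    by (intro left_ideal.intro additive_subgroup.intro left_ideal_axioms.intro ring_axioms)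
qed

section \<open>Chinese remainder theorem for left modules\<close>

text \<open>
  The preimage of \<open>(I +> a, J +> b)\<close> is the coset of \<open>a \<otimes> f \<oplus> b \<otimes> e\<close>; no product of
  an ideal element with a ring element on its right occurs, so one-sided ideals suffice.
\<close>

lemma left_chinese_remainder:
  fixes R (structure)
  assumes I: "left_ideal I R" and J: "left_ideal J R" and K: "left_ideal K R"
    and IJ: "I \<inter> J = K"
    and e: "e \<in> I" and f: "f \<in> J" and ef: "e \<oplus> f = \<one>"
  shows "\<exists>\<Psi>. \<Psi> \<in> left_module_iso R (quot_module R K)
    (prod_module (quot_module R I) (quot_module R J))"
proof -
  interpret I: left_ideal I R by (rule I)
  interpret J: left_ideal J R by (rule J)
  interpret K: left_ideal K R by (rule K)
  interpret IS: abelian_subgroup I R by (rule I.abelian_subgroup)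
  interpret JS: abelian_subgroup J R by (rule J.abelian_subgroup)
  interpret KS: abelian_subgroup K R by (rule K.abelian_subgroup)
  have absorb: "set_add R L K = L" if "left_ideal L R" "K \<subseteq> L" for L
  proof -
    interpret L: left_ideal L R by (rule that)
    show ?thesis
    proof
      show "set_add R L K \<subseteq> L"
        using \<open>K \<subseteq> L\<close> additive_subgroup.a_closed[OF L.additive_subgroup_axioms]
        unfolding set_add_def' by blast
      show "L \<subseteq> set_add R L K"
      proof
        fix x assume "x \<in> L"
        then have "x = x \<oplus> \<zero>" by (simp add: L.a_Hcarr)
        then show "x \<in> set_add R L K"
          using \<open>x \<in> L\<close> K.zero_closed unfolding set_add_def' by blast
      qed
    qed
  qed
  \<comment> \<open>Adding an ideal to the whole coset avoids choosing representatives;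
    \<open>absorb\<close> turns I + (K + x) into I + x.\<close>
  define \<Psi> where "\<Psi> X = (set_add R I X, set_add R J X)" for X
  have \<Psi>: "\<Psi> (K +> x) = (I +> x, J +> x)" if "x \<in> carrier R" for x
    using that absorb[OF I] absorb[OF J] IJ
    by (auto simp: \<Psi>_def I.a_setmult_rcos_assoc I.a_subset J.a_subset K.a_subset)
  have cosets: "a_rcosets L = (\<lambda>x. L +> x) ` carrier R" for L
    by (auto simp: A_RCOSETS_def')
  have inj: "inj_on \<Psi> (a_rcosets K)"
    using IJ by (auto simp: inj_on_def cosets \<Psi> I.rcos_eq_iff J.rcos_eq_iff K.rcos_eq_iff)
  have surj: "\<Psi> ` (a_rcosets K) = (a_rcosets I) \<times> (a_rcosets J)"
  proof (intro equalityI subsetI)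
    fix Z assume "Z \<in> (a_rcosets I) \<times> (a_rcosets J)"
    then obtain a b where ab: "a \<in> carrier R" "b \<in> carrier R" "Z = (I +> a, J +> b)"
      by (auto simp: cosets)
    define x where "x = a \<otimes> f \<oplus> b \<otimes> e"
    have c: "e \<in> carrier R" "f \<in> carrier R" using e f by auto
    have x: "x \<in> carrier R" using ab c by (simp add: x_def)
    \<comment> \<open>Splitting \<open>a\<close> and \<open>b\<close> along e + f = 1 cancels the
      summand shared with \<open>x\<close> and leaves a left multiple of \<open>e\<close> or
      \<open>f\<close>.\<close>
    have ae: "a = a \<otimes> f \<oplus> a \<otimes> e" and bf: "b = b \<otimes> e \<oplus> b \<otimes> f"
      using ab c ef by (metis I.r_distr I.r_one I.a_comm I.m_closed)+
    have "x \<ominus> a = b \<otimes> e \<ominus> a \<otimes> e"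
      using ab c by (subst ae) (simp add: x_def I.add_minus_add_left)
    moreover have "x \<ominus> b = a \<otimes> f \<ominus> b \<otimes> f"
      using ab c by (subst bf) (simp add: x_def I.a_comm[of "a \<otimes> f"] I.add_minus_add_left)
    ultimately have "x \<ominus> a = (b \<ominus> a) \<otimes> e" "x \<ominus> b = (a \<ominus> b) \<otimes> f"
      using ab c by (simp_all add: I.minus_eq I.l_distr I.l_minus)
    then have "x \<ominus> a \<in> I" "x \<ominus> b \<in> J"
      using ab e f by (auto simp: I.I_l_closed J.I_l_closed)
    then have "\<Psi> (K +> x) = Z"
      using ab x by (simp add: \<Psi> I.rcos_eq_iff J.rcos_eq_iff)
    then show "Z \<in> \<Psi> ` (a_rcosets K)" using x by (auto simp: cosets)
  qed (auto simp: cosets \<Psi>)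
  have carr: "carrier (quot_module R L) = a_rcosets L" for L
    by (simp add: quot_module_def)
  have smult: "\<Psi> (r \<odot>\<^bsub>quot_module R K\<^esub> X) =
      r \<odot>\<^bsub>prod_module (quot_module R I) (quot_module R J)\<^esub> \<Psi> X"
    if "r \<in> carrier R" "X \<in> a_rcosets K" for r X
    using that
    by (auto simp: cosets \<Psi> prod_module_def I.quot_module_smult J.quot_module_smult
        K.quot_module_smult)
  have "\<Psi> \<in> iso (add_monoid (quot_module R K))
      (add_monoid (prod_module (quot_module R I) (quot_module R J)))"
    unfolding iso_def hom_def bij_betw_def
    using inj surj
    by (auto simp: prod_module_def quot_module_def cosets \<Psi> IS.a_rcos_sum JS.a_rcos_sum
        KS.a_rcos_sum)
  then have "\<Psi> \<in> left_module_iso R (quot_module R K)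
      (prod_module (quot_module R I) (quot_module R J))"
    using smult by (simp add: left_module_iso_def carr)
  then show ?thesis by blast
qed

section \<open>Hurwitz quaternions\<close>

lemma hurwitz_ring_simps [simp]:
  "carrier hurwitz_ring = hurwitz" "x \<otimes>\<^bsub>hurwitz_ring\<^esub> y = x * y" "\<one>\<^bsub>hurwitz_ring\<^esub> = 1"
  "x \<oplus>\<^bsub>hurwitz_ring\<^esub> y = x + y" "\<zero>\<^bsub>hurwitz_ring\<^esub> = 0"
  by (simp_all add: hurwitz_ring_def)

lemma hurwitz_of_int: "of_int n \<in> hurwitz"
  by (rule hurwitzI[of _ n 0 0 0]) (simp add: quat_of_int)

lemma hurwitz_of_nat: "of_nat n \<in> hurwitz"
  using hurwitz_of_int[of "int n"] by simp

lemma hurwitz_units: "qi \<in> hurwitz" "qj \<in> hurwitz" "qk \<in> hurwitz"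
proof -
  show "qi \<in> hurwitz" by (rule hurwitzI[of _ 0 0 1 0]) (simp add: qi_def)
  show "qj \<in> hurwitz" by (rule hurwitzI[of _ 0 0 0 1]) (simp add: qj_def)
  \<comment> \<open>The basis is 1, i, j, omega, and k = -1 - i - j + 2 omega; the omega coefficient
    is the second integer passed to \<open>hurwitzI\<close>.\<close>
  show "qk \<in> hurwitz" by (rule hurwitzI[of _ "-1" 2 "-1" "-1"]) (simp add: qk_def)
qed

lemma quat_of_nat_commute: "of_nat n * x = x * of_nat n" for x :: quat
  by (simp add: quat_of_nat quat_eq_iff)

lemma quat_of_nat_cancel: "of_nat n * x = of_nat n * y \<Longrightarrow> n > 0 \<Longrightarrow> x = y" for x y :: quat
  by (simp add: quat_of_nat quat_eq_iff)

section \<open>Conjugation, norm and half-integral coordinates\<close>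

lemma qcnj_qcnj [simp]: "qcnj (qcnj x) = x"
  by (simp add: qcnj_def)

lemma qcnj_mult: "qcnj (x * y) = qcnj y * qcnj x"
  by (simp add: quat_eq_iff qcnj_def algebra_simps)

lemma qnrm_qcnj [simp]: "qnrm (qcnj x) = qnrm x"
  by (simp add: qnrm_def qcnj_def)

lemma qnrm_mult: "qnrm (x * y) = qnrm x * qnrm y"
  by (simp add: qnrm_def power2_eq_square algebra_simps)

lemma qnrm_add: "qnrm (x + y) = qnrm x + qnrm y + 2 * qre (x * qcnj y)"
  by (simp add: qnrm_def qcnj_def power2_eq_square algebra_simps)

lemma qcnj_mult_self: "qcnj x * x = x * qcnj x"
  by (simp add: quat_eq_iff qcnj_def algebra_simps)

lemma hurwitz_qcnj:
  assumes "x \<in> hurwitz"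
  shows "qcnj x \<in> hurwitz"
proof (rule hurwitzE[OF assms])
  fix a1 a2 a3 a4 :: int
  assume "x = Quat (of_int a1 + of_int a4 / 2) (of_int a2 + of_int a4 / 2)
    (of_int a3 + of_int a4 / 2) (of_int a4 / 2)"
  \<comment> \<open>The conjugate of omega is 1 - omega, which moves \<open>a4\<close> into the
    first coefficient.\<close>
  then show ?thesis
    by (intro hurwitzI[of _ "a1 + a4" "- a4" "- a2" "- a3"]) (simp add: qcnj_def)
qed

lemma hurwitz_half_coords:
  assumes "x \<in> hurwitz"
  obtains A B C D :: int where "x = Quat (of_int A / 2) (of_int B / 2) (of_int C / 2) (of_int D / 2)"
proof (rule hurwitzE[OF assms])
  fix a1 a2 a3 a4 :: int
  assume "x = Quat (of_int a1 + of_int a4 / 2) (of_int a2 + of_int a4 / 2)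
    (of_int a3 + of_int a4 / 2) (of_int a4 / 2)"
  then show ?thesis
    by (intro that[of "2*a1 + a4" "2*a2 + a4" "2*a3 + a4" a4]) (simp add: add_divide_distrib)
qed

lemma hurwitz_qnrm_int:
  assumes "x \<in> hurwitz"
  obtains n :: int where "qnrm x = of_int n"
proof (rule hurwitzE[OF assms])
  fix a1 a2 a3 a4 :: int
  assume "x = Quat (of_int a1 + of_int a4 / 2) (of_int a2 + of_int a4 / 2)
    (of_int a3 + of_int a4 / 2) (of_int a4 / 2)"
  \<comment> \<open>Each squared coordinate contributes a quarter of \<open>a4^2\<close>, and the
    four quarters add up to an integer.\<close>
  then show ?thesis
    by (intro that[of "a1^2 + a2^2 + a3^2 + (a1 + a2 + a3) * a4 + a4^2"])
      (simp add: qnrm_def power2_eq_square field_simps)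
qed

text \<open>As \<open>p\<close> is odd, divisibility descends from the doubled coordinates to the
  coefficients over 1, i, j, omega, so the quotient by \<open>p\<close> is again a Hurwitz
  quaternion.\<close>

lemma hurwitz_dvd:
  assumes x: "x \<in> hurwitz" and "odd p"
    and xe: "x = Quat (of_int A / 2) (of_int B / 2) (of_int C / 2) (of_int D / 2)"
    and dvd: "int p dvd A" "int p dvd B" "int p dvd C" "int p dvd D"
  obtains z where "z \<in> hurwitz" "x = of_nat p * z"
proof (rule hurwitzE[OF x])
  fix a1 a2 a3 a4 :: int
  assume xa: "x = Quat (of_int a1 + of_int a4 / 2) (of_int a2 + of_int a4 / 2)
    (of_int a3 + of_int a4 / 2) (of_int a4 / 2)"
  have eq: "A = 2*a1 + a4" "B = 2*a2 + a4" "C = 2*a3 + a4" "D = a4"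
  proof -
    have "of_int A = (of_int (2*a1 + a4) :: rat)" "of_int B = (of_int (2*a2 + a4) :: rat)"
      "of_int C = (of_int (2*a3 + a4) :: rat)" "of_int D = (of_int a4 :: rat)"
      using xa unfolding xe by (simp_all add: field_simps)
    then show "A = 2*a1 + a4" "B = 2*a2 + a4" "C = 2*a3 + a4" "D = a4"
      by (simp_all only: of_int_eq_iff)
  qed
  have cop: "coprime (int p) 2" using \<open>odd p\<close> by simp
  have d4: "int p dvd a4" using dvd eq by simp
  have "int p dvd 2 * a1" "int p dvd 2 * a2" "int p dvd 2 * a3"
    using dvd d4 eq by (metis dvd_add_left_iff)+
  then have "int p dvd a1" "int p dvd a2" "int p dvd a3"
    using cop by (simp_all add: coprime_dvd_mult_right_iff)
  with d4 obtain b1 b2 b3 b4 where b: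
    "a1 = int p * b1" "a2 = int p * b2" "a3 = int p * b3" "a4 = int p * b4"
    by (auto simp: dvd_def)
  let ?z = "Quat (of_int b1 + of_int b4 / 2) (of_int b2 + of_int b4 / 2)
    (of_int b3 + of_int b4 / 2) (of_int b4 / 2)"
  have "?z \<in> hurwitz" by (rule hurwitzI) simp
  moreover have "x = of_nat p * ?z"
    unfolding xa b by (simp add: quat_of_nat quat_eq_iff algebra_simps)
  ultimately show ?thesis by (rule that)
qed

section \<open>Principal left ideals of the Hurwitz order\<close>

lemma PIdl_hurwitz: "PIdl\<^bsub>hurwitz_ring\<^esub> x = {h * x |h. h \<in> hurwitz}"
  by (auto simp: cgenideal_def)

lemma left_ideal_PIdl_hurwitz: "x \<in> hurwitz \<Longrightarrow> left_ideal (PIdl\<^bsub>hurwitz_ring\<^esub> x) hurwitz_ring"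
  by (rule ring.cgenideal_left_ideal[OF ring_hurwitz_ring]) simp

lemma ideal_PIdl_of_nat: "ideal (PIdl\<^bsub>hurwitz_ring\<^esub> (of_nat p)) hurwitz_ring"
proof -
  interpret L: left_ideal "PIdl\<^bsub>hurwitz_ring\<^esub> (of_nat p)" hurwitz_ring
    by (rule left_ideal_PIdl_hurwitz) (rule hurwitz_of_nat)
  show ?thesis
  proof (rule idealI)
    show "ring hurwitz_ring" by (rule ring_hurwitz_ring)
    show "subgroup (PIdl\<^bsub>hurwitz_ring\<^esub> (of_nat p)) (add_monoid hurwitz_ring)" by (rule L.a_subgroup)
    fix a x assume ax: "a \<in> PIdl\<^bsub>hurwitz_ring\<^esub> (of_nat p)" "x \<in> carrier hurwitz_ring"
    then show "x \<otimes>\<^bsub>hurwitz_ring\<^esub> a \<in> PIdl\<^bsub>hurwitz_ring\<^esub> (of_nat p)" by (rule L.I_l_closed)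
    from ax obtain h where h: "h \<in> hurwitz" "a = h * of_nat p" by (auto simp: PIdl_hurwitz)
    then have "a * x = (h * x) * of_nat p"
      using quat_of_nat_commute[of p x] by (simp add: mult.assoc)
    then show "a \<otimes>\<^bsub>hurwitz_ring\<^esub> x \<in> PIdl\<^bsub>hurwitz_ring\<^esub> (of_nat p)"
      using h ax hurwitz_mult by (auto simp: PIdl_hurwitz)
  qed
qed

text \<open>Since \<open>of_nat p\<close> is central, its left multiples already form a two-sided
  ideal; all later computations can therefore use left multiples.\<close>

lemma Idl_of_nat: "Idl\<^bsub>hurwitz_ring\<^esub> {of_nat p} = PIdl\<^bsub>hurwitz_ring\<^esub> (of_nat p)"
proof
  interpret ring hurwitz_ring by (rule ring_hurwitz_ring)
  have p: "of_nat p \<in> carrier hurwitz_ring" by (simp add: hurwitz_of_nat)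
  show "Idl\<^bsub>hurwitz_ring\<^esub> {of_nat p} \<subseteq> PIdl\<^bsub>hurwitz_ring\<^esub> (of_nat p)"
    by (rule genideal_minimal[OF ideal_PIdl_of_nat]) (simp add: cgenideal_self[OF p])
  show "PIdl\<^bsub>hurwitz_ring\<^esub> (of_nat p) \<subseteq> Idl\<^bsub>hurwitz_ring\<^esub> {of_nat p}"
    using p by (intro cgenideal_minimal genideal_ideal genideal_self') simp_all
qed

text \<open>By multiplicativity of the norm, 1 = h x would make \<open>p\<close> divide 1. Here
  \<open>p\<close> need not be prime: the lemma is also applied with \<open>p ^ 2\<close>, the norm
  of \<open>of_nat p\<close>.\<close>

lemma one_not_in_PIdl:
  assumes "x \<in> hurwitz" "qnrm x = of_nat p" "p > 1"
  shows "1 \<notin> PIdl\<^bsub>hurwitz_ring\<^esub> x"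
proof
  assume "1 \<in> PIdl\<^bsub>hurwitz_ring\<^esub> x"
  then obtain h where h: "h \<in> hurwitz" "1 = h * x" by (auto simp: PIdl_hurwitz)
  obtain n :: int where n: "qnrm h = of_int n" by (rule hurwitz_qnrm_int[OF h(1)])
  have "qnrm 1 = qnrm h * qnrm x" unfolding h(2) by (rule qnrm_mult)
  then have "of_int (n * int p) = (of_int 1 :: rat)"
    using n assms by (simp add: qnrm_def)
  then have "n * int p = 1" by (simp only: of_int_eq_iff)
  then show False using \<open>p > 1\<close> by (simp add: zmult_eq_1_iff)
qed

section \<open>Maximality of the left ideal of an element of norm p\<close>

text \<open>If \<open>p\<close> divided the norm of b + h x for all h, it would divide the doubled
  coordinates of \<open>b * qcnj x\<close>, forcing \<open>b\<close> into the left ideal of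
  \<open>x\<close>. So some y = b + h x has norm n prime to \<open>p\<close>, and a Bezout identity
  for n and \<open>p\<close> becomes one for \<open>qcnj y * y\<close> and
  \<open>qcnj x * x\<close>.\<close>

lemma hurwitz_comaximal_qnrm:
  assumes p: "prime p" "odd p" and x: "x \<in> hurwitz" "qnrm x = of_nat p"
    and b: "b \<in> hurwitz" "b \<notin> PIdl\<^bsub>hurwitz_ring\<^esub> x"
  shows "\<exists>r\<in>hurwitz. \<exists>q\<in>PIdl\<^bsub>hurwitz_ring\<^esub> x. r * b + q = 1"
proof -
  have p0: "p > 0" using p(1) by (rule prime_gt_0_nat)
  have xx: "qcnj x * x = of_nat p"
    by (simp add: qcnj_mult_self mult_qcnj x quat_of_nat)
  define c where "c = b * qcnj x"
  have c: "c \<in> hurwitz" using b x by (simp add: c_def hurwitz_mult hurwitz_qcnj)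
  obtain A B C D where ce: "c = Quat (of_int A / 2) (of_int B / 2) (of_int C / 2) (of_int D / 2)"
    by (rule hurwitz_half_coords[OF c])
  \<comment> \<open>Modulo \<open>p\<close> the norm of \<open>b + h * x\<close> is \<open>qnrm b\<close> plus the reduced trace of \<open>c * qcnj h\<close>;
    for \<open>h = 1, i, j, k\<close> these traces are the doubled coordinates of \<open>c\<close>.\<close>
  have nrm: "qnrm (b + h * x) = qnrm b + qnrm h * of_nat p + 2 * qre (c * qcnj h)" for h
    by (simp only: qnrm_add qnrm_mult x qcnj_mult c_def mult.assoc)
  have "\<exists>h\<in>hurwitz. \<exists>n. qnrm (b + h * x) = of_int n \<and> \<not> int p dvd n"
  proof (rule ccontr)
    assume "\<not> ?thesis"
    then have all: "int p dvd n" if "h \<in> hurwitz" "qnrm (b + h * x) = of_int n" for h n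
      using that by blast
    obtain n0 where n0: "qnrm b = of_int n0" by (rule hurwitz_qnrm_int[OF b(1)])
    then have pn0: "int p dvd n0" using all[OF hurwitz_0] by simp
    have tr: "int p dvd t" if "h \<in> hurwitz" "qnrm h = 1" "2 * qre (c * qcnj h) = of_int t" for h t
    proof -
      have "int p dvd n0 + int p + t"
        by (rule all[OF that(1)]) (simp add: nrm n0 that del: quat_sel_mult)
      then show ?thesis using pn0 by (simp add: dvd_add_right_iff)
    qed
    have "int p dvd A" by (rule tr[OF hurwitz_1]) (simp_all add: ce qnrm_def qcnj_def)
    moreover have "int p dvd B"
      by (rule tr[OF hurwitz_units(1)]) (simp_all add: ce qnrm_def qcnj_def qi_def)
    moreover have "int p dvd C"
      by (rule tr[OF hurwitz_units(2)]) (simp_all add: ce qnrm_def qcnj_def qj_def)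
    moreover have "int p dvd D"
      by (rule tr[OF hurwitz_units(3)]) (simp_all add: ce qnrm_def qcnj_def qk_def)
    ultimately obtain z where z: "z \<in> hurwitz" "c = of_nat p * z"
      using hurwitz_dvd[OF c p(2) ce] by blast
    \<comment> \<open>Multiplying \<open>c = of_nat p * z\<close> on the right by \<open>x\<close>
      restores the norm of \<open>x\<close>, so a factor \<open>p\<close> cancels on both
      sides.\<close>
    have "of_nat p * b = b * (qcnj x * x)" by (simp add: xx quat_of_nat_commute)
    also have "\<dots> = of_nat p * (z * x)" using z(2) by (simp add: c_def mult.assoc[symmetric])
    finally have "b = z * x" using quat_of_nat_cancel p0 by blast
    then show False using b(2) z(1) by (auto simp: PIdl_hurwitz)
  qed
  then obtain h n where h: "h \<in> hurwitz" and n: "qnrm (b + h * x) = of_int n" "\<not> int p dvd n" by blast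
  have "coprime n (int p)"
    using prime_imp_coprime[of "int p" n] n(2) p(1) by (simp add: coprime_commute)
  then obtain u v where uv: "u * n + v * int p = 1"
    by (metis bezout_int coprime_iff_gcd_eq_1)
  define y where "y = b + h * x"
  have y: "y \<in> hurwitz" using b x h by (simp add: y_def hurwitz_add hurwitz_mult)
  have yy: "qcnj y * y = of_int n"
    using n(1) by (simp add: qcnj_mult_self mult_qcnj y_def quat_of_int)
  \<comment> \<open>These are the coefficients of \<open>b\<close> and \<open>x\<close> after
    expanding u (\<open>qcnj y\<close> y) + v (\<open>qcnj x\<close> x) with y = b + h x.\<close>
  let ?r = "of_int u * qcnj y" and ?s = "of_int u * qcnj y * h + of_int v * qcnj x"
  have "?r * b + ?s * x = of_int u * (qcnj y * y) + of_int v * (qcnj x * x)"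
    by (simp add: y_def algebra_simps)
  also have "\<dots> = of_int (u * n + v * int p)" by (simp add: yy xx)
  finally have "?r * b + ?s * x = 1" by (simp add: uv)
  moreover have "?r \<in> hurwitz" "?s \<in> hurwitz"
    using x y h by (simp_all add: hurwitz_mult hurwitz_add hurwitz_of_int hurwitz_qcnj)
  ultimately show ?thesis by (auto simp: PIdl_hurwitz)
qed

lemma left_prime_PIdl_hurwitz:
  assumes "prime p" "odd p" and "x \<in> hurwitz" "qnrm x = of_nat p"
  shows "left_prime hurwitz_ring (PIdl\<^bsub>hurwitz_ring\<^esub> x)"
  using one_not_in_PIdl[OF assms(3,4)] prime_gt_1_nat[OF assms(1)] hurwitz_comaximal_qnrm[OF assms]
  by (intro left_ideal.left_primeI left_ideal_PIdl_hurwitz assms(3)) simp_all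

section \<open>Primality of the two-sided ideal of p\<close>

text \<open>Conjugation by a unit i, j or k fixes the real part and its own coordinate and negates
  the other two, so the imaginary parts cancel. Each summand stays in any two-sided ideal containing
  \<open>w\<close>.\<close>

lemma quat_trace_identity:
  "w + (- qi) * w * qi + (- qj) * w * qj + (- qk) * w * qk = Quat (4 * qre w) 0 0 0"
  by (simp add: quat_eq_iff qi_def qj_def qk_def)

text \<open>Applied to w, wi, wj and wk, the trace identity puts twice each doubled coordinate of
  \<open>w\<close>, up to sign, into \<open>W\<close>. If \<open>p\<close> divided all of these
  coordinates, \<open>w\<close> would be a multiple of \<open>p\<close>; hence \<open>W\<close>
  contains an integer prime to \<open>p\<close>.\<close>

lemma two_sided_prime_of_nat:
  assumes p: "prime p" "odd p"
  shows "two_sided_prime hurwitz_ring (PIdl\<^bsub>hurwitz_ring\<^esub> (of_nat p))"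
proof (rule ideal.two_sided_primeI[OF ideal_PIdl_of_nat])
  have "qnrm (of_nat p) = of_nat (p ^ 2)" by (simp add: quat_of_nat qnrm_def)
  then show "\<one>\<^bsub>hurwitz_ring\<^esub> \<notin> PIdl\<^bsub>hurwitz_ring\<^esub> (of_nat p)"
    using one_not_in_PIdl[OF hurwitz_of_nat, of p "p ^ 2"] prime_gt_1_nat[OF p(1)]
    by (simp add: one_less_power del: One_nat_def)
  fix W assume W: "ideal W hurwitz_ring" and "\<not> W \<subseteq> PIdl\<^bsub>hurwitz_ring\<^esub> (of_nat p)"
  then obtain w where w: "w \<in> W" "w \<notin> PIdl\<^bsub>hurwitz_ring\<^esub> (of_nat p)" by blast
  interpret W: ideal W hurwitz_ring by (rule W)
  have wH: "w \<in> hurwitz" using w W.a_Hcarr by simp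
  have l: "h * y \<in> W" and r: "y * h \<in> W" if "h \<in> hurwitz" "y \<in> W" for h y
    using that W.I_l_closed[of y h] W.I_r_closed[of y h] by simp_all
  have add: "y + z \<in> W" if "y \<in> W" "z \<in> W" for y z
    using additive_subgroup.a_closed[OF W.additive_subgroup_axioms that] by simp
  have re: "of_int (2 * A) \<in> W" if y: "y \<in> W" "qre y = of_int A / 2" for y A
  proof -
    have "Quat (4 * qre y) 0 0 0 \<in> W"
      unfolding quat_trace_identity[symmetric]
      using y(1) by (intro add l r hurwitz_units hurwitz_uminus)
    then show ?thesis using y(2) by (simp add: quat_of_int)
  qed
  obtain A B C D where we: "w = Quat (of_int A / 2) (of_int B / 2) (of_int C / 2) (of_int D / 2)"
    by (rule hurwitz_half_coords[OF wH])
  have "of_int (2 * A) \<in> W"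
    by (rule re[OF w(1)]) (simp add: we)
  moreover have "of_int (2 * - B) \<in> W"
    by (rule re[OF r[OF hurwitz_units(1) w(1)]]) (simp add: we qi_def)
  moreover have "of_int (2 * - C) \<in> W"
    by (rule re[OF r[OF hurwitz_units(2) w(1)]]) (simp add: we qj_def)
  moreover have "of_int (2 * - D) \<in> W"
    by (rule re[OF r[OF hurwitz_units(3) w(1)]]) (simp add: we qk_def)
  moreover have "\<not> (int p dvd A \<and> int p dvd B \<and> int p dvd C \<and> int p dvd D)"
  proof
    assume "int p dvd A \<and> int p dvd B \<and> int p dvd C \<and> int p dvd D"
    then obtain z where "z \<in> hurwitz" "w = of_nat p * z"
      using hurwitz_dvd[OF wH p(2) we] by blast
    then show False using w(2) by (auto simp: PIdl_hurwitz quat_of_nat_commute)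
  qed
  ultimately obtain m where m: "of_int (2 * m) \<in> W" "\<not> int p dvd m"
    by (metis dvd_minus_iff)
  have "coprime (2 * m) (int p)"
    using prime_imp_coprime[of "int p" m] m(2) p by (simp add: coprime_commute)
  then obtain u v where uv: "u * (2 * m) + v * int p = 1"
    by (metis bezout_int coprime_iff_gcd_eq_1)
  have "of_int u * of_int (2 * m) + of_int v * of_nat p = (of_int (u * (2 * m) + v * int p) :: quat)"
    by simp
  then have "of_int u * of_int (2 * m) + of_int v * of_nat p = (1 :: quat)" by (simp only: uv of_int_1)
  moreover have "of_int u * of_int (2 * m) \<in> W" by (rule l[OF hurwitz_of_int m(1)])
  moreover have "of_int v * of_nat p \<in> PIdl\<^bsub>hurwitz_ring\<^esub> (of_nat p)"
    using hurwitz_of_int by (auto simp: PIdl_hurwitz)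
  ultimately show "\<exists>w\<in>W. \<exists>q\<in>PIdl\<^bsub>hurwitz_ring\<^esub> (of_nat p). w \<oplus>\<^bsub>hurwitz_ring\<^esub> q = \<one>\<^bsub>hurwitz_ring\<^esub>"
    by auto
qed

section \<open>The ideals of an element and its conjugate, and the isomorphism\<close>

text \<open>The trace \<open>t\<close> is invertible modulo \<open>p\<close>. For y in both ideals,
  y t is a multiple of \<open>p\<close>, hence so is y; the same Bezout identity, with
  \<open>t\<close> and \<open>p\<close> written through \<open>x\<close> and \<open>qcnj x\<close>,
  gives comaximality.\<close>

lemma hurwitz_ideal_pair:
  assumes x: "x \<in> hurwitz" "qnrm x = of_nat p"
    and t: "x + qcnj x = of_int t" "coprime t (int p)"
  shows "PIdl\<^bsub>hurwitz_ring\<^esub> x \<inter> PIdl\<^bsub>hurwitz_ring\<^esub> (qcnj x) = PIdl\<^bsub>hurwitz_ring\<^esub> (of_nat p)"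
    and "\<exists>e\<in>PIdl\<^bsub>hurwitz_ring\<^esub> x. \<exists>f\<in>PIdl\<^bsub>hurwitz_ring\<^esub> (qcnj x). e + f = 1"
proof -
  have xx: "qcnj x * x = of_nat p" "x * qcnj x = of_nat p"
    by (simp_all add: qcnj_mult_self mult_qcnj x quat_of_nat)
  have cx: "qcnj x \<in> hurwitz" using x by (simp add: hurwitz_qcnj)
  obtain u v where uv: "u * t + v * int p = 1"
    using t(2) by (metis bezout_int coprime_iff_gcd_eq_1)
  then have one: "of_int u * of_int t + of_int v * of_nat p = (1 :: quat)"
    by (metis of_int_1 of_int_add of_int_mult of_int_of_nat_eq)
  show "PIdl\<^bsub>hurwitz_ring\<^esub> x \<inter> PIdl\<^bsub>hurwitz_ring\<^esub> (qcnj x) = PIdl\<^bsub>hurwitz_ring\<^esub> (of_nat p)"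
  proof (intro equalityI subsetI)
    fix y assume "y \<in> PIdl\<^bsub>hurwitz_ring\<^esub> x \<inter> PIdl\<^bsub>hurwitz_ring\<^esub> (qcnj x)"
    then obtain a b where ab: "a \<in> hurwitz" "b \<in> hurwitz" "y = a * x" "y = b * qcnj x"
      by (auto simp: PIdl_hurwitz)
    have "y * of_int t = y * x + y * qcnj x" by (simp add: t(1)[symmetric] distrib_left)
    \<comment> \<open>The two representations of \<open>y\<close> are used crosswise, so that
      \<open>x\<close> meets its conjugate in both products.\<close>
    also have "\<dots> = b * (qcnj x * x) + a * (x * qcnj x)"
      using ab(3,4) by (metis mult.assoc)
    also have "\<dots> = (a + b) * of_nat p" by (simp add: xx distrib_right)
    finally have yt: "y * of_int t = (a + b) * of_nat p" .
    have "y = y * (of_int t * of_int u) + y * (of_int v * of_nat p)"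
      using one by (metis distrib_left mult.right_neutral mult_of_int_commute)
    also have "y * (of_int t * of_int u) = ((a + b) * of_int u) * of_nat p"
      by (simp add: mult.assoc[symmetric] yt) (simp add: mult.assoc quat_of_nat_commute)
    finally have "y = ((a + b) * of_int u + y * of_int v) * of_nat p"
      by (simp add: algebra_simps)
    moreover have "(a + b) * of_int u + y * of_int v \<in> hurwitz"
      using ab(1,2) x(1) unfolding ab(3) by (intro hurwitz_add hurwitz_mult hurwitz_of_int)
    ultimately show "y \<in> PIdl\<^bsub>hurwitz_ring\<^esub> (of_nat p)" by (auto simp: PIdl_hurwitz)
  next
    fix y assume "y \<in> PIdl\<^bsub>hurwitz_ring\<^esub> (of_nat p)"
    then obtain h where h: "h \<in> hurwitz" "y = h * of_nat p" by (auto simp: PIdl_hurwitz)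
    then have "y = (h * qcnj x) * x" "y = (h * x) * qcnj x" by (simp_all add: mult.assoc xx)
    moreover have "h * qcnj x \<in> hurwitz" "h * x \<in> hurwitz"
      using h x cx by (simp_all add: hurwitz_mult)
    ultimately show "y \<in> PIdl\<^bsub>hurwitz_ring\<^esub> x \<inter> PIdl\<^bsub>hurwitz_ring\<^esub> (qcnj x)"
      unfolding PIdl_hurwitz by blast
  qed
  \<comment> \<open>The term v p is rewritten as v (\<open>qcnj x\<close> x) and credited to the
    left ideal of \<open>x\<close>.\<close>
  let ?a = "of_int u + of_int v * qcnj x"
  have "?a * x + of_int u * qcnj x = of_int u * (x + qcnj x) + of_int v * (qcnj x * x)"
    by (simp add: algebra_simps)
  also have "\<dots> = 1" by (simp add: t(1) xx one)
  finally have "?a * x + of_int u * qcnj x = 1" .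
  moreover have "?a \<in> hurwitz" "of_int u \<in> hurwitz"
    using cx by (simp_all add: hurwitz_add hurwitz_mult hurwitz_of_int)
  ultimately show "\<exists>e\<in>PIdl\<^bsub>hurwitz_ring\<^esub> x. \<exists>f\<in>PIdl\<^bsub>hurwitz_ring\<^esub> (qcnj x). e + f = 1"
    unfolding PIdl_hurwitz by blast
qed

theorem theorem2:
  fixes p :: nat and \<pi> :: quat
  assumes "prime p" and "odd p"
    and "\<pi> \<in> hurwitz" and "qnrm \<pi> = of_nat p" and "qre \<pi> \<in> {1, 2}"
  shows "two_sided_prime hurwitz_ring (Idl\<^bsub>hurwitz_ring\<^esub> {of_nat p})
    \<and> left_prime hurwitz_ring (PIdl\<^bsub>hurwitz_ring\<^esub> \<pi>)
    \<and> left_prime hurwitz_ring (PIdl\<^bsub>hurwitz_ring\<^esub> (qcnj \<pi>))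
    \<and> (\<exists>\<Psi>. \<Psi> \<in> left_module_iso hurwitz_ring
          (quot_module hurwitz_ring (Idl\<^bsub>hurwitz_ring\<^esub> {of_nat p}))
          (prod_module
            (quot_module hurwitz_ring (PIdl\<^bsub>hurwitz_ring\<^esub> \<pi>))
            (quot_module hurwitz_ring (PIdl\<^bsub>hurwitz_ring\<^esub> (qcnj \<pi>)))))"
proof -
  let ?P = "PIdl\<^bsub>hurwitz_ring\<^esub> (of_nat p)"
  have c: "qcnj \<pi> \<in> hurwitz" "qnrm (qcnj \<pi>) = of_nat p"
    using assms(3,4) by (simp_all add: hurwitz_qcnj)
  obtain t where t: "t \<in> {2, 4 :: int}" "of_int t = 2 * qre \<pi>"
    using assms(5) that[of 2] that[of 4] by auto
  have "coprime 2 (int p)" using assms(2) by simp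
  \<comment> \<open>Both possible values of \<open>t\<close> are powers of 2.\<close>
  then have "coprime (2 ^ 1) (int p)" "coprime (2 ^ 2) (int p)"
    by (simp_all only: coprime_power_left_iff simp_thms)
  then have cop: "coprime t (int p)" using t(1) by auto
  have "\<pi> + qcnj \<pi> = of_int t" by (simp add: quat_of_int t(2) quat_eq_iff qcnj_def)
  note pair = hurwitz_ideal_pair[OF assms(3,4) this cop]
  obtain e f where "e \<in> PIdl\<^bsub>hurwitz_ring\<^esub> \<pi>" "f \<in> PIdl\<^bsub>hurwitz_ring\<^esub> (qcnj \<pi>)" "e + f = 1"
    using pair(2) by blast
  then have "\<exists>\<Psi>. \<Psi> \<in> left_module_iso hurwitz_ring (quot_module hurwitz_ring ?P)
      (prod_module (quot_module hurwitz_ring (PIdl\<^bsub>hurwitz_ring\<^esub> \<pi>))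
        (quot_module hurwitz_ring (PIdl\<^bsub>hurwitz_ring\<^esub> (qcnj \<pi>))))"
    using left_chinese_remainder[OF left_ideal_PIdl_hurwitz[OF assms(3)]
        left_ideal_PIdl_hurwitz[OF c(1)] left_ideal_PIdl_hurwitz[OF hurwitz_of_nat] pair(1)]
    by simp
  then show ?thesis
    using two_sided_prime_of_nat[OF assms(1,2)] left_prime_PIdl_hurwitz[OF assms(1-4)]
      left_prime_PIdl_hurwitz[OF assms(1,2) c]
    by (simp add: Idl_of_nat)
qed

end
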